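(* For every $c\in(0,\tfrac12)$ there is a constant $C>0$ such that the following holds. Let $p\in(0,\tfrac12]$, $K>0$, and let $f\colon\{0,1\}^n\to\{0,1\}$ be a monotone Boolean function with $c\le \mu_p(f)\le 1-c$ and $\mathrm{I}[f]\le K/p$. Then there is a set $J\subseteq[n]$ with $|J|\le CK$ such that \[\mu_p(f_{J\to1})\ge \mu_p(f)+e^{-CK}.\]
   Context: $\mu_p$ is the $p$-biased product measure on $\{0,1\}^n$ and $\mu_p(f)=\mathbb{E}_{\mu_p}[f]$. $f$ is monotone if $f(x)\le f(y)$ whenever $x_i\le y_i$ for all $i$. The total influence is $\mathrm{I}[f]=\sum_{i=1}^n\Pr_{\mathbf{x}\sim\mu_p}[f(\mathbf{x}\oplus e_i)\ne f(\mathbf{x})]$. For $J\subseteq[n]$, $f_{J\to1}$ is the function on the remaining coordinates obtained by setting all coordinates in $J$ to $1$, and $\mu_p(f_{J\to1})$ is its $\mu_p$-measure. (The paper states this with "$\mu_p(f)$ bounded away from $0$ and $1$", "$O(K)$ coordinates" and "$e^{-O(K)}$", made explicit here via the constants $c$ and $C$.) *)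

theory Defs
  imports "HOL-Probability.Product_PMF"
begin

text \<open>
  The dimension n is quantified inside the statement (the constant must not depend on it), so it
  cannot be a type. A point of the cube over a finite coordinate set A is a function on
  \<^typ>\<open>nat\<close> that takes the value \<^term>\<open>False\<close> outside A, with \<^term>\<open>True\<close> for 1 and
  \<^term>\<open>False\<close> for 0. The set of coordinates [n] is \<open>{1..n}\<close>. The values of a Boolean function
  outside the cube are never used below.
\<close>

definition cube :: "nat set \<Rightarrow> (nat \<Rightarrow> bool) set" where
  "cube A = PiE_dflt A False (\<lambda>_. UNIV)"

definition biased :: "real \<Rightarrow> nat set \<Rightarrow> (nat \<Rightarrow> bool) pmf" where
  "biased p A = Pi_pmf A False (\<lambda>_. bernoulli_pmf p)"

definition mu :: "real \<Rightarrow> nat set \<Rightarrow> ((nat \<Rightarrow> bool) \<Rightarrow> bool) \<Rightarrow> real" where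
  "mu p A f = measure_pmf.expectation (biased p A) (\<lambda>x. of_bool (f x))"

definition monotone_bf :: "nat set \<Rightarrow> ((nat \<Rightarrow> bool) \<Rightarrow> bool) \<Rightarrow> bool" where
  "monotone_bf A f \<longleftrightarrow>
     (\<forall>x\<in>cube A. \<forall>y\<in>cube A. (\<forall>i\<in>A. x i \<le> y i) \<longrightarrow> f x \<le> f y)"

definition flip :: "nat \<Rightarrow> (nat \<Rightarrow> bool) \<Rightarrow> (nat \<Rightarrow> bool)" where
  "flip i x = x(i := \<not> x i)"

definition total_influence :: "real \<Rightarrow> nat set \<Rightarrow> ((nat \<Rightarrow> bool) \<Rightarrow> bool) \<Rightarrow> real" where
  "total_influence p A f =
     (\<Sum>i\<in>A. measure_pmf.prob (biased p A) {x. f (flip i x) \<noteq> f x})"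

text \<open>For f on the cube over A and J a subset of A, this is a function on the cube over A - J.\<close>

definition restrict_one :: "nat set \<Rightarrow> ((nat \<Rightarrow> bool) \<Rightarrow> bool) \<Rightarrow> ((nat \<Rightarrow> bool) \<Rightarrow> bool)" where
  "restrict_one J f = (\<lambda>x. f (\<lambda>i. if i \<in> J then True else x i))"

end

(* Suppose that setting to 1 any set J of at most r coordinates raises mu_p(f) by at most delta.
   Then J shifts f by little also when it is compared with setting J to 0, and this bounds the
   total Fourier weight above J by (8 sigma^2)^|J| delta, where sigma^2 = p (1 - p). In this
   regime the biased cube has a global hypercontractive inequality: the degree < r part h of
   sigma D_i f, where D_i is the discrete derivative, has small fourth moment. As sigma D_i f
   takes only the values 0 and sigma, its correlation with h, which is |h|^2, is a small
   multiple of sigma^2 E[D_i f]. Summing over i, the Fourier weight of f on the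
   levels 1..r is a small multiple of K, while the weight above level r is at most K/r because
   the total influence is at most K/p. For r a large enough multiple of K/c the
   variance of f is then smaller than c(1-c), a contradiction. The Poincare inequality gives
   K >= c/2, which absorbs the rounding in the choice of r. *)
theory Submission
  imports Defs
begin

section \<open>Sums over the subsets of a finite set\<close>

lemma sum_Pow_insert:
  fixes g :: "'a set \<Rightarrow> 'b::comm_monoid_add"
  assumes "finite A" "i \<notin> A"
  shows "(\<Sum>S\<in>Pow (insert i A). g S) = (\<Sum>S\<in>Pow A. g S) + (\<Sum>S\<in>Pow A. g (insert i S))"
proof -
  have "(\<Sum>S\<in>Pow (insert i A). g S) = (\<Sum>S\<in>Pow A. g S) + (\<Sum>S\<in>insert i ` Pow A. g S)"
    unfolding Pow_insert using assms by (intro sum.union_disjoint) auto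
  also have "(\<Sum>S\<in>insert i ` Pow A. g S) = (\<Sum>S\<in>Pow A. g (insert i S))"
    using assms by (intro sum.reindex_cong[of "insert i"]) (auto simp: inj_on_def)
  finally show ?thesis .
qed

text \<open>Double counting of the pairs of a set \<open>S\<close> and an element \<open>i\<close>
  of it. With \<open>g\<close> a squared Fourier coefficient, a sum weighted by level becomes a sum
  over derivatives.\<close>

lemma card_weighted_sum:
  fixes g :: "'a set \<Rightarrow> real"
  assumes "finite A"
  shows "(\<Sum>S\<in>Pow A. card S * g S) = (\<Sum>i\<in>A. \<Sum>T\<in>Pow (A - {i}). g (insert i T))"
proof -
  have "(\<Sum>S\<in>Pow A. card S * g S) = (\<Sum>S\<in>Pow A. \<Sum>i\<in>A. if i \<in> S then g S else 0)"
  proof (intro sum.cong refl)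
    fix S assume "S \<in> Pow A"
    then have "A \<inter> S = S" by auto
    then show "card S * g S = (\<Sum>i\<in>A. if i \<in> S then g S else 0)"
      using assms by (simp add: sum.If_cases)
  qed
  also have "\<dots> = (\<Sum>i\<in>A. \<Sum>S\<in>Pow A. if i \<in> S then g S else 0)"
    by (rule sum.swap)
  also have "\<dots> = (\<Sum>i\<in>A. \<Sum>T\<in>Pow (A - {i}). g (insert i T))"
  proof (rule sum.cong[OF refl])
    fix i assume "i \<in> A"
    then have A: "A = insert i (A - {i})" by auto
    have "(\<Sum>S\<in>Pow (A - {i}). if i \<in> S then g S else 0) = 0"
      by (intro sum.neutral) auto
    then show "(\<Sum>S\<in>Pow A. if i \<in> S then g S else 0) = (\<Sum>T\<in>Pow (A - {i}). g (insert i T))"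
      using assms by (subst A, subst sum_Pow_insert) auto
  qed
  finally show ?thesis .
qed

section \<open>Expectation and characters on the biased cube\<close>

locale biased_cube =
  fixes p :: real
  assumes p_pos: "0 < p" and p_less_1: "p < 1"
begin

definition E :: "nat set \<Rightarrow> ((nat \<Rightarrow> bool) \<Rightarrow> real) \<Rightarrow> real" where
  "E A F = measure_pmf.expectation (biased p A) F"

definition s2 :: real where "s2 = p * (1 - p)"

text \<open>A coordinate centred and divided by its standard deviation, so that it has mean 0 and
  variance 1; the products \<open>chi S\<close> are then the Fourier basis of the biased
  measure.\<close>

definition phi :: "bool \<Rightarrow> real" where
  "phi b = (if b then 1 - p else - p) / sqrt s2"

definition chi :: "nat set \<Rightarrow> (nat \<Rightarrow> bool) \<Rightarrow> real" where
  "chi S x = (\<Prod>i\<in>S. phi (x i))"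

definition coef :: "nat set \<Rightarrow> ((nat \<Rightarrow> bool) \<Rightarrow> real) \<Rightarrow> nat set \<Rightarrow> real" where
  "coef A F S = E A (\<lambda>x. F x * chi S x)"

lemma s2_pos: "0 < s2" and s2_le: "4 * s2 \<le> 1"
proof -
  show "0 < s2" using p_pos p_less_1 by (simp add: s2_def)
  have "0 \<le> (1 - 2 * p)\<^sup>2" by simp
  then show "4 * s2 \<le> 1" by (simp add: s2_def power2_eq_square algebra_simps)
qed

lemma set_biased: "finite A \<Longrightarrow> set_pmf (biased p A) \<subseteq> cube A"
  unfolding biased_def cube_def
  by (rule order_trans[OF set_Pi_pmf_subset']) (auto simp: PiE_dflt_def)

lemma finite_biased: "finite A \<Longrightarrow> finite (set_pmf (biased p A))"
  by (rule finite_subset[OF set_biased]) (auto simp: cube_def intro!: finite_PiE_dflt)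

lemma integrable_biased:
  fixes F :: "(nat \<Rightarrow> bool) \<Rightarrow> real"
  shows "finite A \<Longrightarrow> integrable (biased p A) F"
  by (intro integrable_measure_pmf_finite finite_biased)

lemma E_add: "finite A \<Longrightarrow> E A (\<lambda>x. F x + G x) = E A F + E A G"
  by (simp add: E_def integrable_biased)

lemma E_diff: "finite A \<Longrightarrow> E A (\<lambda>x. F x - G x) = E A F - E A G"
  by (simp add: E_def integrable_biased)

lemma E_cmult: "E A (\<lambda>x. c * F x) = c * E A F"
  by (simp add: E_def)

lemma E_mult_right: "E A (\<lambda>x. F x * c) = E A F * c"
  by (simp add: E_def)

lemma E_const: "E A (\<lambda>x. c) = c"
  by (simp add: E_def)

lemma E_sum: "finite A \<Longrightarrow> E A (\<lambda>x. \<Sum>s\<in>S. F s x) = (\<Sum>s\<in>S. E A (F s))"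
  by (simp add: E_def integrable_biased)

lemma E_mono: "finite A \<Longrightarrow> (\<And>x. x \<in> cube A \<Longrightarrow> F x \<le> G x) \<Longrightarrow> E A F \<le> E A G"
  unfolding E_def using set_biased
  by (intro integral_mono_AE integrable_biased) (auto simp: AE_measure_pmf_iff)

lemma E_cong: "finite A \<Longrightarrow> (\<And>x. x \<in> cube A \<Longrightarrow> F x = G x) \<Longrightarrow> E A F = E A G"
  by (intro antisym E_mono) auto

lemma E_abs: "finite A \<Longrightarrow> \<bar>E A F\<bar> \<le> E A (\<lambda>x. \<bar>F x\<bar>)"
  unfolding E_def by (rule integral_abs_bound)

lemma E_empty: "E {} F = F (\<lambda>_. False)"
  by (simp add: E_def biased_def)

text \<open>Conditioning on one coordinate; all inductions on the dimension below rest on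
  it.\<close>

lemma E_insert:
  assumes "finite A" "i \<notin> A"
  shows "E (insert i A) F = p * E A (\<lambda>x. F (x(i := True))) + (1 - p) * E A (\<lambda>x. F (x(i := False)))"
proof -
  have fin: "finite (set_pmf (Pi_pmf A False (\<lambda>_. bernoulli_pmf p)))"
    using finite_biased[OF assms(1)] by (simp add: biased_def)
  have "E (insert i A) F = (\<Sum>y\<in>UNIV. pmf (bernoulli_pmf p) y * E A (\<lambda>x. F (x(i := y))))"
    unfolding E_def biased_def using assms fin
    by (simp add: Pi_pmf_insert' pmf_expectation_bind[where A = UNIV]
        flip: map_pmf_def)
  also have "\<dots> = p * E A (\<lambda>x. F (x(i := True))) + (1 - p) * E A (\<lambda>x. F (x(i := False)))"
    using p_pos p_less_1 by (simp add: UNIV_bool)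
  finally show ?thesis .
qed

text \<open>Fubini for two independent blocks of coordinates; the inner function glues a point over
  \<open>A\<close> to a point over \<open>U\<close>.\<close>

lemma E_Un:
  assumes "finite U" "finite A" "A \<inter> U = {}"
  shows "E (A \<union> U) F = E A (\<lambda>x. E U (\<lambda>y. F (\<lambda>i. if i \<in> U then y i else x i)))"
  using assms(1,3)
proof (induction U arbitrary: F)
  case empty
  then show ?case by (simp add: E_empty)
next
  case (insert j U)
  have upd: "(\<lambda>i. if i \<in> insert j U then (y(j := b)) i else x i)
      = (\<lambda>i. if i \<in> U then y i else x i)(j := b)" for x y :: "nat \<Rightarrow> bool" and b
    using insert.hyps by (auto simp: fun_eq_iff)
  have "E (insert j (A \<union> U)) F
      = p * E (A \<union> U) (\<lambda>x. F (x(j := True))) + (1 - p) * E (A \<union> U) (\<lambda>x. F (x(j := False)))"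
    using insert assms by (intro E_insert) auto
  with insert assms(2) show ?case
    by (simp add: E_insert upd E_add E_cmult del: insert_iff)
qed

section \<open>Moments of the normalised coordinate\<close>

lemma phi_mean: "p * phi True + (1 - p) * phi False = 0"
  by (simp add: phi_def field_simps)

lemma phi_var: "p * (phi True)\<^sup>2 + (1 - p) * (phi False)\<^sup>2 = 1"
proof -
  have "p * (phi True)\<^sup>2 + (1 - p) * (phi False)\<^sup>2 = (p * (1-p)^2 + (1-p) * p^2) / s2"
    using s2_pos by (simp add: phi_def power_divide add_divide_distrib)
  also have "p * (1-p)^2 + (1-p) * p^2 = s2" by (simp add: s2_def power2_eq_square algebra_simps)
  finally show ?thesis using s2_pos by simp
qed

text \<open>The mass-weighted values are opposite. Hence a coefficient at a set containing
  \<open>i\<close> is \<open>sqrt s2\<close> times a difference of two restrictions, and the first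
  absolute moment of \<open>phi\<close> is \<open>2 * sqrt s2\<close>.\<close>

lemma phi_weighted: "p * phi True = sqrt s2" "(1 - p) * phi False = - sqrt s2"
proof -
  have "p * (1 - p) / sqrt s2 = sqrt s2"
    using s2_pos by (simp add: s2_def real_div_sqrt)
  then show "p * phi True = sqrt s2" "(1 - p) * phi False = - sqrt s2"
    by (simp_all add: phi_def mult.commute)
qed

text \<open>Stated for the square, since AM-GM in \<open>two_point\<close> turns the third moment
  into its square.\<close>

lemma phi_third: "(p * (phi True)^3 + (1 - p) * (phi False)^3)\<^sup>2 \<le> 1 / s2"
proof -
  have "p * (phi True)^3 + (1 - p) * (phi False)^3 = (p * (1-p)^3 - (1-p) * p^3) / sqrt s2 ^ 3"
    by (simp add: phi_def power_divide diff_divide_distrib[of "p * (1 - p)^3"])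
  also have "p * (1-p)^3 - (1-p) * p^3 = s2 * (1 - 2 * p)"
    by (simp add: s2_def power2_eq_square power3_eq_cube algebra_simps)
  also have "sqrt s2 ^ 3 = s2 * sqrt s2"
    using s2_pos by (simp add: power3_eq_cube)
  finally have "(p * (phi True)^3 + (1 - p) * (phi False)^3)\<^sup>2 = (1 - 2 * p)\<^sup>2 / s2"
    using s2_pos by (simp add: power_divide)
  also have "\<dots> \<le> 1 / s2"
    using s2_pos p_pos p_less_1 by (intro divide_right_mono) (auto simp: abs_square_le_1)
  finally show ?thesis .
qed

lemma phi_fourth: "p * (phi True)^4 + (1 - p) * (phi False)^4 \<le> 1 / s2"
proof -
  have "p * (phi True)^4 + (1 - p) * (phi False)^4 = (p * (1-p)^4 + (1-p) * p^4) / sqrt s2 ^ 4"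
    by (simp add: phi_def power_divide add_divide_distrib)
  also have "p * (1-p)^4 + (1-p) * p^4 = s2 * (1 - 3 * s2)"
    by (simp add: s2_def power2_eq_square power4_eq_xxxx algebra_simps)
  also have "sqrt s2 ^ 4 = s2 * s2"
    using s2_pos by (simp add: power4_eq_xxxx)
  also have "s2 * (1 - 3 * s2) / (s2 * s2) \<le> 1 / s2"
    using s2_pos by (simp add: field_simps)
  finally show ?thesis .
qed

section \<open>Fourier coefficients and Parseval's identity\<close>

lemma chi_upd: "i \<notin> S \<Longrightarrow> chi S (x(i := b)) = chi S x"
  unfolding chi_def by (intro prod.cong) auto

lemma chi_insert: "finite S \<Longrightarrow> i \<notin> S \<Longrightarrow> chi (insert i S) x = phi (x i) * chi S x"
  by (simp add: chi_def)

lemma coef_insert: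
  assumes "finite A" "i \<notin> A" "S \<subseteq> A"
  shows "coef (insert i A) F S
      = p * coef A (\<lambda>x. F (x(i := True))) S + (1 - p) * coef A (\<lambda>x. F (x(i := False))) S"
    and "coef (insert i A) F (insert i S)
      = sqrt s2 * (coef A (\<lambda>x. F (x(i := True))) S - coef A (\<lambda>x. F (x(i := False))) S)"
proof -
  have S: "finite S" "i \<notin> S" using assms finite_subset by auto
  show "coef (insert i A) F S
      = p * coef A (\<lambda>x. F (x(i := True))) S + (1 - p) * coef A (\<lambda>x. F (x(i := False))) S"
    using assms S by (simp add: coef_def E_insert chi_upd)
  have eq: "E A (\<lambda>x. G x * (c * chi S x)) = c * E A (\<lambda>x. G x * chi S x)" for G c
    by (simp add: E_cmult[symmetric] mult_ac)
  have "coef (insert i A) F (insert i S)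
      = (p * phi True) * coef A (\<lambda>x. F (x(i := True))) S
        + ((1 - p) * phi False) * coef A (\<lambda>x. F (x(i := False))) S"
    using assms S by (simp add: coef_def E_insert chi_upd chi_insert eq)
  then show "coef (insert i A) F (insert i S)
      = sqrt s2 * (coef A (\<lambda>x. F (x(i := True))) S - coef A (\<lambda>x. F (x(i := False))) S)"
    by (simp only: phi_weighted) (simp add: algebra_simps)
qed

lemma parseval:
  assumes "finite A"
  shows "(\<Sum>S\<in>Pow A. (coef A F S)\<^sup>2) = E A (\<lambda>x. (F x)\<^sup>2)"
  using assms
proof (induction A arbitrary: F)
  case empty
  then show ?case by (simp add: coef_def E_empty chi_def)
next
  case (insert i A)
  \<comment> \<open>Parseval for one coordinate: squared mean plus variance is the second
    moment.\<close>
  have sq: "(p * u + (1 - p) * v)\<^sup>2 + (sqrt s2 * (u - v))\<^sup>2 = p * u\<^sup>2 + (1 - p) * v\<^sup>2" for u v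
    using s2_pos by (simp add: power_mult_distrib) (simp add: s2_def power2_eq_square algebra_simps)
  have "(\<Sum>S\<in>Pow (insert i A). (coef (insert i A) F S)\<^sup>2)
      = (\<Sum>S\<in>Pow A. (coef (insert i A) F S)\<^sup>2 + (coef (insert i A) F (insert i S))\<^sup>2)"
    using insert.hyps by (simp add: sum_Pow_insert sum.distrib)
  also have "\<dots> = (\<Sum>S\<in>Pow A. p * (coef A (\<lambda>x. F (x(i := True))) S)\<^sup>2
      + (1 - p) * (coef A (\<lambda>x. F (x(i := False))) S)\<^sup>2)"
    using insert.hyps by (intro sum.cong refl) (simp add: coef_insert sq)
  also have "\<dots> = p * E A (\<lambda>x. (F (x(i := True)))\<^sup>2) + (1 - p) * E A (\<lambda>x. (F (x(i := False)))\<^sup>2)"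
    by (simp add: sum.distrib insert.IH sum_distrib_left[symmetric])
  also have "\<dots> = E (insert i A) (\<lambda>x. (F x)\<^sup>2)"
    using insert.hyps by (simp add: E_insert)
  finally show ?case .
qed

section \<open>Global hypercontractivity\<close>

text \<open>The noise operator of rate 1/2 applied to the polynomial with coefficients
  \<open>a\<close>. The family \<open>a\<close> is arbitrary because splitting off a coordinate
  \<open>i\<close> produces the shifted family \<open>a (insert i S)\<close>.\<close>

definition smoothed :: "nat set \<Rightarrow> (nat set \<Rightarrow> real) \<Rightarrow> (nat \<Rightarrow> bool) \<Rightarrow> real" where
  "smoothed A a x = (\<Sum>S\<in>Pow A. (1/2) ^ card S * a S * chi S x)"

text \<open>The Fourier weight above \<open>U\<close>, which is the squared norm of the normalised
  derivative in the directions \<open>U\<close>.\<close>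

definition W :: "nat set \<Rightarrow> (nat set \<Rightarrow> real) \<Rightarrow> nat set \<Rightarrow> real" where
  "W A a U = (\<Sum>S\<in>Pow A. if U \<subseteq> S then (a S)\<^sup>2 else 0)"

lemma W_nonneg: "0 \<le> W A a U"
  unfolding W_def by (intro sum_nonneg) auto

lemma smoothed_insert:
  assumes "finite A" "i \<notin> A"
  shows "smoothed (insert i A) a (x(i := b))
    = smoothed A a x + phi b / 2 * smoothed A (\<lambda>S. a (insert i S)) x"
proof -
  have "chi S (x(i := b)) = chi S x" "chi (insert i S) (x(i := b)) = phi b * chi S x"
    "card (insert i S) = Suc (card S)" if "S \<in> Pow A" for S
  proof -
    have "finite S" "i \<notin> S" using that assms finite_subset by auto
    then show "chi S (x(i := b)) = chi S x" "chi (insert i S) (x(i := b)) = phi b * chi S x"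
      "card (insert i S) = Suc (card S)"
      by (auto simp: chi_upd chi_insert)
  qed
  then show ?thesis
    using assms by (simp add: smoothed_def sum_Pow_insert sum_distrib_left mult_ac)
qed

lemma W_insert:
  assumes "finite A" "i \<notin> A" "U \<subseteq> A"
  shows "W (insert i A) a U = W A a U + W A (\<lambda>S. a (insert i S)) U"
    and "W (insert i A) a (insert i U) = W A (\<lambda>S. a (insert i S)) U"
proof -
  let ?a' = "\<lambda>S. a (insert i S)"
  have "(\<Sum>S\<in>Pow A. if U \<subseteq> insert i S then (?a' S)\<^sup>2 else 0) = W A ?a' U"
    unfolding W_def using assms by (intro sum.cong refl) (auto simp: subset_insert)
  then show "W (insert i A) a U = W A a U + W A ?a' U"
    using assms by (simp add: W_def sum_Pow_insert)
  have "(\<Sum>S\<in>Pow A. if insert i U \<subseteq> insert i S then (?a' S)\<^sup>2 else 0) = W A ?a' U"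
    unfolding W_def using assms by (intro sum.cong refl) (auto simp: subset_insert)
  moreover have "(\<Sum>S\<in>Pow A. if insert i U \<subseteq> S then (a S)\<^sup>2 else 0) = 0"
    using assms by (intro sum.neutral) auto
  ultimately show "W (insert i A) a (insert i U) = W A ?a' U"
    unfolding W_def by (simp only: sum_Pow_insert[OF assms(1,2)] add_0)
qed

text \<open>After expansion in powers of \<open>phi\<close>, the linear term vanishes and the
  quadratic one has moment 1. AM-GM distributes the mixed terms, and the noise factor 1/2 leaves
  room for constants 1. Only the term with \<open>b\<close> and \<open>d\<close> meets the third and
  fourth moments at full size, hence its factor \<open>1 / s2\<close>.\<close>

lemma two_point:
  fixes a b c d :: real
  shows "p * ((a + phi True / 2 * b)\<^sup>2 * (c + phi True / 2 * d)\<^sup>2)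
    + (1 - p) * ((a + phi False / 2 * b)\<^sup>2 * (c + phi False / 2 * d)\<^sup>2)
    \<le> a\<^sup>2 * c\<^sup>2 + a\<^sup>2 * d\<^sup>2 + b\<^sup>2 * c\<^sup>2 + (1 / s2) * (b\<^sup>2 * d\<^sup>2)"
proof -
  define m3 where "m3 = p * (phi True)^3 + (1 - p) * (phi False)^3"
  define m4 where "m4 = p * (phi True)^4 + (1 - p) * (phi False)^4"
  define u where "u = phi True"
  define v where "v = phi False"
  have m3: "m3\<^sup>2 \<le> 1 / s2" and m4: "m4 \<le> 1 / s2"
    using phi_third phi_fourth by (simp_all add: m3_def m4_def)
  have expand: "(a + t / 2 * b)\<^sup>2 * (c + t / 2 * d)\<^sup>2
    = a\<^sup>2 * c\<^sup>2 + t * (a\<^sup>2 * c * d + a * b * c\<^sup>2)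
      + t\<^sup>2 * (a\<^sup>2 * d\<^sup>2 / 4 + b\<^sup>2 * c\<^sup>2 / 4 + a * b * c * d)
      + t^3 * ((a * b * d\<^sup>2 + b\<^sup>2 * c * d) / 4) + t^4 * (b\<^sup>2 * d\<^sup>2 / 16)" for t
    by (simp add: power2_eq_square power3_eq_cube power4_eq_xxxx field_simps)
  have moments: "p * (X0 + u * X1 + u\<^sup>2 * X2 + u^3 * X3 + u^4 * X4)
      + (1 - p) * (X0 + v * X1 + v\<^sup>2 * X2 + v^3 * X3 + v^4 * X4)
    = X0 + (p * u + (1 - p) * v) * X1 + (p * u\<^sup>2 + (1 - p) * v\<^sup>2) * X2
      + (p * u^3 + (1 - p) * v^3) * X3 + (p * u^4 + (1 - p) * v^4) * X4" for X0 X1 X2 X3 X4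
    by (simp add: algebra_simps)
  have "p * ((a + u / 2 * b)\<^sup>2 * (c + u / 2 * d)\<^sup>2)
      + (1 - p) * ((a + v / 2 * b)\<^sup>2 * (c + v / 2 * d)\<^sup>2)
    = a\<^sup>2 * c\<^sup>2 + (p * u + (1 - p) * v) * (a\<^sup>2 * c * d + a * b * c\<^sup>2)
      + (p * u\<^sup>2 + (1 - p) * v\<^sup>2) * (a\<^sup>2 * d\<^sup>2 / 4 + b\<^sup>2 * c\<^sup>2 / 4 + a * b * c * d)
      + (p * u^3 + (1 - p) * v^3) * ((a * b * d\<^sup>2 + b\<^sup>2 * c * d) / 4)
      + (p * u^4 + (1 - p) * v^4) * (b\<^sup>2 * d\<^sup>2 / 16)"
    unfolding expand by (rule moments)
  also have "\<dots> = a\<^sup>2 * c\<^sup>2 + (a\<^sup>2 * d\<^sup>2 / 4 + b\<^sup>2 * c\<^sup>2 / 4 + a * b * c * d)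
      + m3 * ((a * b * d\<^sup>2 + b\<^sup>2 * c * d) / 4) + m4 * (b\<^sup>2 * d\<^sup>2 / 16)"
    using phi_mean phi_var by (simp add: u_def v_def m3_def m4_def)
  also have "\<dots> \<le> a\<^sup>2 * c\<^sup>2 + a\<^sup>2 * d\<^sup>2 + b\<^sup>2 * c\<^sup>2 + (1 / s2) * (b\<^sup>2 * d\<^sup>2)"
  proof -
    define L where "L = (1 / s2) * (b\<^sup>2 * d\<^sup>2)"
    have amgm: "x * y \<le> (x\<^sup>2 + y\<^sup>2) / 2" for x y :: real
      using sum_squares_bound[of x y] by simp
    have "a * b * c * d \<le> (a\<^sup>2 * d\<^sup>2 + b\<^sup>2 * c\<^sup>2) / 2"
      using amgm[of "a * d" "b * c"] by (simp add: power_mult_distrib mult_ac)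
    moreover have "m3 * (a * b * d\<^sup>2) \<le> (a\<^sup>2 * d\<^sup>2 + m3\<^sup>2 * (b\<^sup>2 * d\<^sup>2)) / 2"
      using amgm[of "a * d" "m3 * (b * d)"] by (simp add: power_mult_distrib power2_eq_square mult_ac)
    moreover have "m3 * (b\<^sup>2 * c * d) \<le> (b\<^sup>2 * c\<^sup>2 + m3\<^sup>2 * (b\<^sup>2 * d\<^sup>2)) / 2"
      using amgm[of "b * c" "m3 * (b * d)"] by (simp add: power_mult_distrib power2_eq_square mult_ac)
    moreover have "m3\<^sup>2 * (b\<^sup>2 * d\<^sup>2) \<le> L"
      unfolding L_def using m3 by (intro mult_right_mono) auto
    moreover have "m4 * (b\<^sup>2 * d\<^sup>2) \<le> L"
      unfolding L_def using m4 by (intro mult_right_mono) auto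
    moreover have "0 \<le> a\<^sup>2 * d\<^sup>2" "0 \<le> b\<^sup>2 * c\<^sup>2" "0 \<le> L"
      using s2_pos by (auto simp: L_def)
    moreover have "m3 * ((a * b * d\<^sup>2 + b\<^sup>2 * c * d) / 4)
        = m3 * (a * b * d\<^sup>2) / 4 + m3 * (b\<^sup>2 * c * d) / 4"
      "m4 * (b\<^sup>2 * d\<^sup>2 / 16) = m4 * (b\<^sup>2 * d\<^sup>2) / 16"
      by (simp_all add: distrib_left add_divide_distrib)
    \<comment> \<open>With each monomial replaced by a variable, collecting the bounds is linear
      arithmetic.\<close>
    moreover have "x + (y / 4 + z / 4 + w) + (t / 4 + t' / 4) + r / 16 \<le> x + y + z + L"
      if "w \<le> (y + z) / 2" "t \<le> (y + q) / 2" "t' \<le> (z + q) / 2" "q \<le> L" "r \<le> L"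
        "0 \<le> y" "0 \<le> z" "0 \<le> L" for x y z w t t' r q :: real
      using that by (simp add: field_simps)
    ultimately show ?thesis unfolding L_def[symmetric] by presburger
  qed
  finally show ?thesis by (simp add: u_def v_def)
qed

text \<open>The fourth moment is the case of equal families. Two families are needed for the
  induction to close: \<open>two_point\<close> creates products of the square of one part with the
  square of another. When all weights \<open>W\<close> are small, the right-hand side is small
  despite the powers of \<open>1 / s2\<close>.\<close>

lemma global_hypercontractivity:
  assumes "finite A"
  shows "E A (\<lambda>x. (smoothed A a x)\<^sup>2 * (smoothed A b x)\<^sup>2)
    \<le> (\<Sum>U\<in>Pow A. (1 / s2) ^ card U * (W A a U * W A b U))"
  using assms
proof (induction A arbitrary: a b)
  case empty
  then show ?case by (simp add: E_empty smoothed_def W_def chi_def)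
next
  case (insert i A)
  define a' where "a' = (\<lambda>S. a (insert i S))"
  define b' where "b' = (\<lambda>S. b (insert i S))"
  let ?Q = "\<lambda>a b. E A (\<lambda>x. (smoothed A a x)\<^sup>2 * (smoothed A b x)\<^sup>2)"
  let ?R = "\<lambda>a b. \<Sum>U\<in>Pow A. (1 / s2) ^ card U * (W A a U * W A b U)"
  have "E (insert i A) (\<lambda>x. (smoothed (insert i A) a x)\<^sup>2 * (smoothed (insert i A) b x)\<^sup>2)
    = E A (\<lambda>x. p * ((smoothed A a x + phi True / 2 * smoothed A a' x)\<^sup>2
                  * (smoothed A b x + phi True / 2 * smoothed A b' x)\<^sup>2)
      + (1 - p) * ((smoothed A a x + phi False / 2 * smoothed A a' x)\<^sup>2
                  * (smoothed A b x + phi False / 2 * smoothed A b' x)\<^sup>2))"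
    using insert.hyps by (simp add: E_insert smoothed_insert E_add E_cmult a'_def b'_def)
  also have "\<dots> \<le> E A (\<lambda>x. (smoothed A a x)\<^sup>2 * (smoothed A b x)\<^sup>2
      + (smoothed A a x)\<^sup>2 * (smoothed A b' x)\<^sup>2 + (smoothed A a' x)\<^sup>2 * (smoothed A b x)\<^sup>2
      + (1 / s2) * ((smoothed A a' x)\<^sup>2 * (smoothed A b' x)\<^sup>2))"
    using insert.hyps by (intro E_mono two_point) auto
  also have "\<dots> = ?Q a b + ?Q a b' + ?Q a' b + (1 / s2) * ?Q a' b'"
    using insert.hyps by (simp only: E_add E_cmult)
  also have "\<dots> \<le> ?R a b + ?R a b' + ?R a' b + (1 / s2) * ?R a' b'"
    using s2_pos by (intro add_mono mult_left_mono insert.IH) auto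
  also have "\<dots> = (\<Sum>U\<in>Pow A. (1 / s2) ^ card U * (W A a U * W A b U)
      + (1 / s2) ^ card U * (W A a U * W A b' U) + (1 / s2) ^ card U * (W A a' U * W A b U)
      + (1 / s2) * ((1 / s2) ^ card U * (W A a' U * W A b' U)))"
    by (simp only: sum.distrib sum_distrib_left)
  also have "\<dots> \<le> (\<Sum>U\<in>Pow A. (1 / s2) ^ card U * (W (insert i A) a U * W (insert i A) b U)
      + (1 / s2) ^ card (insert i U) * (W (insert i A) a (insert i U) * W (insert i A) b (insert i U)))"
  proof (intro sum_mono)
    fix U assume U: "U \<in> Pow A"
    then have "finite U" "i \<notin> U" using insert.hyps finite_subset by auto
    \<comment> \<open>Expanding both weights at \<open>U\<close> gives four products: three match
      the first three terms, and this one is dropped. The term with the extra \<open>1 / s2\<close>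
      is matched exactly by \<open>insert i U\<close>.\<close>
    moreover have "0 \<le> (1 / s2) ^ card U * (W A a' U * W A b' U)"
      using s2_pos W_nonneg by (intro mult_nonneg_nonneg) auto
    ultimately show "(1 / s2) ^ card U * (W A a U * W A b U)
      + (1 / s2) ^ card U * (W A a U * W A b' U) + (1 / s2) ^ card U * (W A a' U * W A b U)
      + (1 / s2) * ((1 / s2) ^ card U * (W A a' U * W A b' U))
      \<le> (1 / s2) ^ card U * (W (insert i A) a U * W (insert i A) b U)
      + (1 / s2) ^ card (insert i U) * (W (insert i A) a (insert i U) * W (insert i A) b (insert i U))"
      using insert.hyps U
      by (simp add: W_insert a'_def[symmetric] b'_def[symmetric] ring_distribs mult.assoc
          del: power_one_over power_divide)
  qed
  also have "\<dots> = (\<Sum>U\<in>Pow (insert i A).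
      (1 / s2) ^ card U * (W (insert i A) a U * W (insert i A) b U))"
    using insert.hyps by (simp add: sum_Pow_insert sum.distrib)
  finally show ?case .
qed

section \<open>Fourier weight above a set and the effect of fixing its coordinates\<close>

lemma W_reindex:
  assumes "finite A" "U \<subseteq> A"
  shows "W A a U = (\<Sum>T\<in>Pow (A - U). (a (T \<union> U))\<^sup>2)"
proof -
  have "W A a U = (\<Sum>S\<in>{S\<in>Pow A. U \<subseteq> S}. (a S)\<^sup>2)"
    unfolding W_def using assms by (intro sum.inter_filter[symmetric]) auto
  also have "\<dots> = (\<Sum>T\<in>Pow (A - U). (a (T \<union> U))\<^sup>2)"
    using assms by (intro sum.reindex_bij_witness[of _ "\<lambda>T. T \<union> U" "\<lambda>S. S - U"])
      (auto simp: Un_absorb2 Un_commute)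
  finally show ?thesis .
qed

text \<open>Since \<open>chi\<close> factorises over \<open>T\<close> and \<open>U\<close>, the
  coordinates in \<open>U\<close> can be integrated out first.\<close>

lemma coef_Un:
  assumes "finite A" "U \<subseteq> A" "T \<subseteq> A - U"
  shows "coef A F (T \<union> U)
    = coef (A - U) (\<lambda>x. E U (\<lambda>y. F (\<lambda>i. if i \<in> U then y i else x i) * chi U y)) T"
proof -
  have fin: "finite U" "finite (A - U)" "finite T"
    using assms by (auto intro: finite_subset)
  have A: "A = (A - U) \<union> U" using assms by auto
  have chi: "chi (T \<union> U) (\<lambda>i. if i \<in> U then y i else x i) = chi U y * chi T x" for x y
  proof -
    have "chi (T \<union> U) (\<lambda>i. if i \<in> U then y i else x i)
      = chi T (\<lambda>i. if i \<in> U then y i else x i) * chi U (\<lambda>i. if i \<in> U then y i else x i)"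
      unfolding chi_def using fin assms by (intro prod.union_disjoint) auto
    also have "chi T (\<lambda>i. if i \<in> U then y i else x i) = chi T x"
      unfolding chi_def using assms by (intro prod.cong) auto
    also have "chi U (\<lambda>i. if i \<in> U then y i else x i) = chi U y"
      unfolding chi_def by (intro prod.cong) auto
    finally show ?thesis by simp
  qed
  have "coef A F (T \<union> U)
    = E (A - U) (\<lambda>x. E U (\<lambda>y. F (\<lambda>i. if i \<in> U then y i else x i) * (chi U y * chi T x)))"
    unfolding coef_def by (subst A, subst E_Un) (use fin chi in auto)
  then show ?thesis
    by (simp only: coef_def mult.assoc[symmetric] E_mult_right)
qed

text \<open>Parseval on \<open>A - U\<close> turns the weight into an expectation that can be
  bounded pointwise in \<open>x\<close>.\<close>

lemma W_coef:
  assumes "finite A" "U \<subseteq> A"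
  shows "W A (coef A F) U
    = E (A - U) (\<lambda>x. (E U (\<lambda>y. F (\<lambda>i. if i \<in> U then y i else x i) * chi U y))\<^sup>2)"
proof -
  have "W A (coef A F) U = (\<Sum>T\<in>Pow (A - U). (coef (A - U)
      (\<lambda>x. E U (\<lambda>y. F (\<lambda>i. if i \<in> U then y i else x i) * chi U y)) T)\<^sup>2)"
    unfolding W_reindex[OF assms] using assms by (intro sum.cong refl) (simp add: coef_Un)
  then show ?thesis using assms by (simp add: parseval)
qed

lemma E_chi:
  assumes "finite U" "U \<noteq> {}"
  shows "E U (chi U) = 0"
proof -
  obtain i V where U: "U = insert i V" "i \<notin> V" using assms(2) by (meson Set.set_insert ex_in_conv)
  then have "finite V" using assms by simp
  then have "E U (chi U) = (p * phi True + (1 - p) * phi False) * E V (chi V)"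
    using U by (simp add: E_insert chi_insert chi_upd E_cmult algebra_simps)
  then show ?thesis by (simp only: phi_mean)
qed

text \<open>Each coordinate contributes \<open>2 * sqrt s2\<close>. Squared, this is the source of
  the small factor \<open>(4 * s2) ^ card U\<close> below.\<close>

lemma E_abs_chi:
  assumes "finite U"
  shows "E U (\<lambda>y. \<bar>chi U y\<bar>) = (2 * sqrt s2) ^ card U"
  using assms
proof (induction U)
  case empty
  then show ?case by (simp add: E_empty chi_def)
next
  case (insert i V)
  have sgn: "0 \<le> phi True" "phi False \<le> 0"
    using p_pos p_less_1 s2_pos by (auto simp: phi_def divide_nonpos_pos)
  have neg: "E V (\<lambda>x. - (phi False * \<bar>chi V x\<bar>)) = - phi False * E V (\<lambda>y. \<bar>chi V y\<bar>)"
    by (subst E_cmult[symmetric]) simp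
  have "E (insert i V) (\<lambda>y. \<bar>chi (insert i V) y\<bar>)
      = p * (phi True * E V (\<lambda>y. \<bar>chi V y\<bar>)) + (1 - p) * (- phi False * E V (\<lambda>y. \<bar>chi V y\<bar>))"
    using insert.hyps sgn by (simp add: E_insert chi_insert chi_upd E_cmult abs_mult neg)
  also have "\<dots> = (p * phi True - (1 - p) * phi False) * E V (\<lambda>y. \<bar>chi V y\<bar>)"
    by (simp add: algebra_simps)
  finally show ?case
    using insert by (simp only: phi_weighted) simp
qed

lemma E_all_False:
  assumes "finite U"
  shows "E U (\<lambda>y. \<Prod>i\<in>U. of_bool (\<not> y i)) = (1 - p) ^ card U"
  using assms
proof (induction U)
  case empty
  then show ?case by (simp add: E_empty)
next
  case (insert i V)
  have "(\<Prod>j\<in>V. of_bool (\<not> (y(i := b)) j) :: real) = (\<Prod>j\<in>V. of_bool (\<not> y j))" for y b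
    using insert.hyps by (intro prod.cong) auto
  then show ?case
    using insert by (simp add: E_insert E_const E_cmult del: fun_upd_apply) (simp add: E_const)
qed

lemma mu_eq: "mu p A f = E A (\<lambda>x. of_bool (f x))"
  by (simp add: mu_def E_def)

text \<open>A point over \<open>A - U\<close> takes the value \<open>False\<close> on
  \<open>U\<close>, so \<open>f x\<close> is already the value of f with the coordinates in
  \<open>U\<close> set to 0.\<close>

lemma monotone_between:
  assumes "monotone_bf A f" "U \<subseteq> A" "x \<in> cube (A - U)" "y \<in> cube U"
  shows "of_bool (f x) \<le> (of_bool (f (\<lambda>i. if i \<in> U then y i else x i)) :: real)"
    and "of_bool (f (\<lambda>i. if i \<in> U then y i else x i)) \<le> (of_bool (restrict_one U f x) :: real)"
proof -
  let ?c = "\<lambda>i. if i \<in> U then y i else x i" and ?o = "\<lambda>i. if i \<in> U then True else x i"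
  have cube: "x \<in> cube A" "?c \<in> cube A" "?o \<in> cube A"
    using assms(2-4) by (auto simp: cube_def PiE_dflt_def)
  have "\<forall>i\<in>A. x i \<le> ?c i" "\<forall>i\<in>A. ?c i \<le> ?o i"
    using assms(3) by (auto simp: cube_def PiE_dflt_def)
  then have "f x \<le> f ?c" "f ?c \<le> f ?o"
    using assms(1) cube by (simp_all only: monotone_bf_def)
  then show "of_bool (f x) \<le> (of_bool (f ?c) :: real)"
    "of_bool (f ?c) \<le> (of_bool (restrict_one U f x) :: real)"
    by (auto simp: restrict_one_def)
qed

text \<open>
  With the coordinates outside U fixed, f is constant in the U-coordinates unless setting them
  all to 1 and all to 0 gives different values; subtracting f with these coordinates at 0 is
  free, since \<open>chi U\<close> has mean 0.
\<close>
lemma W_coef_le: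
  assumes "finite A" "monotone_bf A f" "U \<subseteq> A" "U \<noteq> {}"
  shows "W A (coef A (\<lambda>x. of_bool (f x))) U
    \<le> (4 * s2) ^ card U * (mu p (A - U) (restrict_one U f) - mu p (A - U) f)"
proof -
  let ?F = "\<lambda>x. of_bool (f x) :: real"
  let ?c = "\<lambda>x y i. if i \<in> U then y i else x i"
  define B where "B = (\<lambda>x. of_bool (restrict_one U f x) - ?F x)"
  have fin: "finite U" "finite (A - U)" using assms finite_subset by auto
  have pt: "(E U (\<lambda>y. ?F (?c x y) * chi U y))\<^sup>2 \<le> (4 * s2) ^ card U * B x"
    if x: "x \<in> cube (A - U)" for x
  proof -
    note btw = monotone_between[OF assms(2,3) x]
    have "(\<lambda>_. False) \<in> cube U" by (simp add: cube_def PiE_dflt_def)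
    \<comment> \<open>Monotonicity makes \<open>B x\<close> 0 or 1, hence equal to its square, so
      squaring the bound below costs nothing in this factor.\<close>
    from order_trans[OF btw(1)[OF this] btw(2)[OF this]] have B: "0 \<le> B x" "(B x)\<^sup>2 = B x"
      by (auto simp: B_def)
    have "E U (\<lambda>y. ?F (?c x y) * chi U y) = E U (\<lambda>y. (?F (?c x y) - ?F x) * chi U y)"
      using fin assms(4) by (simp add: left_diff_distrib E_diff E_cmult E_chi)
    also have "\<bar>\<dots>\<bar> \<le> E U (\<lambda>y. \<bar>(?F (?c x y) - ?F x) * chi U y\<bar>)"
      by (rule E_abs[OF fin(1)])
    also have "\<dots> \<le> E U (\<lambda>y. B x * \<bar>chi U y\<bar>)"
    proof (intro E_mono fin)
      fix y assume "y \<in> cube U"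
      then show "\<bar>(?F (?c x y) - ?F x) * chi U y\<bar> \<le> B x * \<bar>chi U y\<bar>"
        using btw[of y] by (auto simp: abs_mult B_def intro!: mult_right_mono)
    qed
    also have "\<dots> = B x * (2 * sqrt s2) ^ card U"
      using fin by (simp add: E_cmult E_abs_chi)
    finally have "(E U (\<lambda>y. ?F (?c x y) * chi U y))\<^sup>2 \<le> (B x * (2 * sqrt s2) ^ card U)\<^sup>2"
      by (rule power2_le_iff_abs_le[THEN iffD2, rotated])
        (use B(1) s2_pos in auto)
    also have "\<dots> = B x * (4 * s2) ^ card U"
    proof -
      have "((2 * sqrt s2) ^ card U)\<^sup>2 = ((2 * sqrt s2)\<^sup>2) ^ card U"
        by (simp only: power_mult[symmetric] mult.commute)
      also have "\<dots> = (4 * s2) ^ card U"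
        using s2_pos by (simp add: power_mult_distrib)
      finally show ?thesis using B(2) by (simp only: power_mult_distrib)
    qed
    finally show ?thesis by (simp add: mult.commute)
  qed
  have "W A (coef A ?F) U \<le> E (A - U) (\<lambda>x. (4 * s2) ^ card U * B x)"
    unfolding W_coef[OF assms(1,3)] using fin pt by (intro E_mono) auto
  also have "\<dots> = (4 * s2) ^ card U * (mu p (A - U) (restrict_one U f) - mu p (A - U) f)"
    using fin by (simp add: E_cmult B_def E_diff mu_eq)
  finally show ?thesis .
qed

text \<open>Passes from comparing \<open>U\<close> set to 1 with f itself to comparing it with
  \<open>U\<close> set to 0. The coordinates in \<open>U\<close> all vanish with probability
  \<open>(1 - p) ^ card U\<close>, at least \<open>2 ^ -card U\<close> as p <= 1/2. On that event f
  loses the whole difference, and elsewhere it is at most its restriction to 1.\<close>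

lemma mu_restrict_diff_le:
  assumes "finite A" "monotone_bf A f" "U \<subseteq> A" "p \<le> 1 / 2"
    and "mu p (A - U) (restrict_one U f) \<le> mu p A f + \<delta>"
  shows "mu p (A - U) (restrict_one U f) - mu p (A - U) f \<le> 2 ^ card U * \<delta>"
proof -
  let ?c = "\<lambda>x y i. if i \<in> U then y i else x i"
  let ?Z = "\<lambda>y. \<Prod>i\<in>U. of_bool (\<not> y i) :: real"
  define m1 where "m1 = mu p (A - U) (restrict_one U f)"
  define m0 where "m0 = mu p (A - U) f"
  define q where "q = (1 - p) ^ card U"
  have fin: "finite U" "finite (A - U)" and A: "A = (A - U) \<union> U"
    using assms finite_subset by auto
  have pt: "of_bool (f (?c x y)) \<le> of_bool (restrict_one U f x)
      - (of_bool (restrict_one U f x) - of_bool (f x)) * ?Z y"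
    if x: "x \<in> cube (A - U)" and y: "y \<in> cube U" for x y
  proof (cases "\<forall>i\<in>U. \<not> y i")
    case True
    then have "?c x y = x" using x by (auto simp: fun_eq_iff cube_def PiE_dflt_def)
    then show ?thesis using True by simp
  next
    case False
    then have "?Z y = 0" using fin(1) by auto
    then show ?thesis
      using monotone_between(2)[OF assms(2,3) x y] by simp
  qed
  have "mu p A f = E (A - U) (\<lambda>x. E U (\<lambda>y. of_bool (f (?c x y))))"
    unfolding mu_eq by (subst A, subst E_Un) (use fin in auto)
  also have "\<dots> \<le> E (A - U) (\<lambda>x. E U (\<lambda>y. of_bool (restrict_one U f x)
      - (of_bool (restrict_one U f x) - of_bool (f x)) * ?Z y))"
    by (intro E_mono fin pt)
  also have "\<dots> = m1 - (m1 - m0) * q"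
    using fin by (simp add: E_diff E_const E_cmult E_mult_right E_all_False mu_eq
        m1_def m0_def q_def)
  finally have *: "(m1 - m0) * q \<le> \<delta>" using assms(5) by (simp add: m1_def)
  have "0 \<le> m1 - m0"
  proof -
    have "(\<lambda>_. False) \<in> cube U" by (simp add: cube_def PiE_dflt_def)
    then have "m0 \<le> m1" unfolding m0_def m1_def mu_eq
      using monotone_between[OF assms(2,3)] by (intro E_mono fin) (meson order_trans)
    then show ?thesis by simp
  qed
  moreover have "1 \<le> 2 ^ card U * q"
    using assms(4) by (simp add: q_def power_mult_distrib[symmetric] one_le_power)
  ultimately have "(m1 - m0) * 1 \<le> (m1 - m0) * (2 ^ card U * q)"
    by (intro mult_left_mono)
  also have "\<dots> = 2 ^ card U * ((m1 - m0) * q)" by simp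
  also have "\<dots> \<le> 2 ^ card U * \<delta>" using * by (intro mult_left_mono) auto
  finally show ?thesis by (simp add: m1_def m0_def)
qed

section \<open>Fourth moments of low-degree functions with small weights\<close>

text \<open>Each \<open>S\<close> is counted once for each of its \<open>2 ^ card S\<close>
  subsets.\<close>

lemma sum_W:
  assumes "finite A"
  shows "(\<Sum>U\<in>Pow A. W A a U) = (\<Sum>S\<in>Pow A. 2 ^ card S * (a S)\<^sup>2)"
proof -
  have "(\<Sum>U\<in>Pow A. W A a U) = (\<Sum>S\<in>Pow A. \<Sum>U\<in>Pow A. if U \<subseteq> S then (a S)\<^sup>2 else 0)"
    unfolding W_def by (rule sum.swap)
  also have "\<dots> = (\<Sum>S\<in>Pow A. 2 ^ card S * (a S)\<^sup>2)"
  proof (intro sum.cong refl)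
    fix S assume S: "S \<in> Pow A"
    then have "{U\<in>Pow A. U \<subseteq> S} = Pow S" by auto
    moreover have "finite S" using S assms finite_subset by auto
    ultimately show "(\<Sum>U\<in>Pow A. if U \<subseteq> S then (a S)\<^sup>2 else 0) = 2 ^ card S * (a S)\<^sup>2"
      using assms by (simp add: sum.inter_filter[symmetric] card_Pow)
  qed
  finally show ?thesis .
qed

text \<open>
  The assumption on \<open>W\<close> caps one of the two factors \<open>W A a U\<close> in the hypercontractive bound,
  with a power of \<open>s2\<close> that cancels the weight \<open>(1 / s2) ^ card U\<close> and leaves one factor \<open>s2\<close>.
\<close>
lemma low_degree_fourth_moment:
  assumes "finite A" and low: "\<And>S. S \<subseteq> A \<Longrightarrow> r \<le> card S \<Longrightarrow> a S = 0" and "0 \<le> \<delta>"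
    and small: "\<And>U. U \<subseteq> A \<Longrightarrow> card U < r \<Longrightarrow> W A a U \<le> (8 * s2) ^ Suc (card U) * \<delta>"
  shows "E A (\<lambda>x. (\<Sum>S\<in>Pow A. a S * chi S x) ^ 4)
    \<le> s2 * 256 ^ r * \<delta> * (\<Sum>S\<in>Pow A. (a S)\<^sup>2)"
proof -
  \<comment> \<open>Undoes the noise factor \<open>(1/2) ^ card S\<close>. As \<open>a\<close> lives
    below level \<open>r\<close>, this costs at most \<open>4 ^ r\<close> in squared
    coefficients.\<close>
  define b where "b S = 2 ^ card S * a S" for S
  have b2: "(b S)\<^sup>2 = 4 ^ card S * (a S)\<^sup>2" for S
    by (simp add: b_def power_mult_distrib power_mult[symmetric] mult.commute[of _ 2])
      (simp add: power_mult)
  have b_le: "(b S)\<^sup>2 \<le> 4 ^ r * (a S)\<^sup>2" if "S \<subseteq> A" for S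
    using low[OF that] by (cases "r \<le> card S") (auto simp: b2 intro!: mult_right_mono)
  have sm: "smoothed A b x = (\<Sum>S\<in>Pow A. a S * chi S x)" for x
    unfolding smoothed_def by (intro sum.cong) (auto simp: b_def power_one_over)
  have W_le: "W A b U \<le> 4 ^ r * W A a U" for U
    unfolding W_def sum_distrib_left by (intro sum_mono) (auto intro: b_le)
  have term_le: "(1 / s2) ^ card U * (W A b U * W A b U) \<le> (32 ^ r * s2 * \<delta>) * W A b U"
    if U: "U \<subseteq> A" for U
  proof (cases "r \<le> card U")
    case True
    have "a S = 0" if "S \<subseteq> A" "U \<subseteq> S" for S
      using low[OF that(1)] True card_mono[OF _ that(2)] that(1) assms(1) finite_subset by force
    then have "W A b U = 0"
      unfolding W_def by (intro sum.neutral) (auto simp: b_def)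
    then show ?thesis by simp
  next
    case False
    \<comment> \<open>The factor 32 is 4, from passing from \<open>a\<close> to \<open>b\<close>,
      times 8, from the assumption on \<open>W\<close>; \<open>Suc (card U)\<close> is at most
      \<open>r\<close>.\<close>
    have "(1 / s2) ^ card U * W A b U
      \<le> (1 / s2) ^ card U * (4 ^ r * ((8 * s2) ^ Suc (card U) * \<delta>))"
      using W_le[of U] small[OF U] False s2_pos
      by (intro mult_left_mono) (auto intro: order_trans mult_left_mono)
    also have "\<dots> = 4 ^ r * 8 ^ Suc (card U) * (s2 * \<delta>)"
      using s2_pos by (simp add: power_mult_distrib power_one_over)
    also have "\<dots> \<le> 4 ^ r * 8 ^ r * (s2 * \<delta>)"
      using False s2_pos assms(3)
      by (intro mult_right_mono mult_left_mono power_increasing) auto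
    also have "\<dots> = 32 ^ r * s2 * \<delta>" by (simp add: power_mult_distrib[symmetric])
    finally have "(1 / s2) ^ card U * W A b U * W A b U \<le> (32 ^ r * s2 * \<delta>) * W A b U"
      by (rule mult_right_mono[OF _ W_nonneg])
    then show ?thesis by (simp only: mult.assoc)
  qed
  have "E A (\<lambda>x. (\<Sum>S\<in>Pow A. a S * chi S x) ^ 4)
    = E A (\<lambda>x. (smoothed A b x)\<^sup>2 * (smoothed A b x)\<^sup>2)"
    by (simp add: sm power2_eq_square power4_eq_xxxx mult.assoc)
  also have "\<dots> \<le> (\<Sum>U\<in>Pow A. (1 / s2) ^ card U * (W A b U * W A b U))"
    by (rule global_hypercontractivity[OF assms(1)])
  also have "\<dots> \<le> (\<Sum>U\<in>Pow A. (32 ^ r * s2 * \<delta>) * W A b U)"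
    by (intro sum_mono term_le) auto
  also have "\<dots> = (32 ^ r * s2 * \<delta>) * (\<Sum>S\<in>Pow A. 2 ^ card S * (b S)\<^sup>2)"
    by (simp add: sum_distrib_left[symmetric] sum_W assms(1))
  \<comment> \<open>Counting subsets gives 2 per level and \<open>b\<close> gives 4, so 8 in all;
    256 is 32 times 8.\<close>
  also have "\<dots> \<le> (32 ^ r * s2 * \<delta>) * (\<Sum>S\<in>Pow A. 8 ^ r * (a S)\<^sup>2)"
  proof (intro mult_left_mono sum_mono)
    fix S assume S: "S \<in> Pow A"
    show "2 ^ card S * (b S)\<^sup>2 \<le> 8 ^ r * (a S)\<^sup>2"
    proof (cases "r \<le> card S")
      case True
      then show ?thesis using low S by (simp add: b_def)
    next
      case False
      have "2 ^ card S * (b S)\<^sup>2 = 8 ^ card S * (a S)\<^sup>2"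
        by (simp add: b2 mult.assoc[symmetric] power_mult_distrib[symmetric])
      with False show ?thesis by (auto intro!: mult_right_mono)
    qed
  qed (use s2_pos assms(3) in auto)
  also have "\<dots> = s2 * 256 ^ r * \<delta> * (\<Sum>S\<in>Pow A. (a S)\<^sup>2)"
  proof -
    have e: "(256::real) ^ r = 32 ^ r * 8 ^ r" by (simp add: power_mult_distrib[symmetric])
    show ?thesis unfolding sum_distrib_left[symmetric] e by (simp only: mult_ac)
  qed
  finally show ?thesis .
qed

section \<open>Discrete derivatives, influence and variance\<close>

text \<open>Independent of \<open>x i\<close>, so it is treated as a function on the cube over
  \<open>A - {i}\<close>.\<close>

definition discrete_deriv :: "nat \<Rightarrow> ((nat \<Rightarrow> bool) \<Rightarrow> bool) \<Rightarrow> (nat \<Rightarrow> bool) \<Rightarrow> real" where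
  "discrete_deriv i f x = of_bool (f (x(i := True))) - of_bool (f (x(i := False)))"

text \<open>The expansion of \<open>sqrt s2\<close> times the derivative is the part of f on sets
  containing \<open>i\<close>, with \<open>i\<close> removed.\<close>

lemma coef_discrete_deriv:
  assumes "finite A" "i \<in> A" "T \<subseteq> A - {i}"
  shows "coef A (\<lambda>x. of_bool (f x)) (insert i T) = sqrt s2 * coef (A - {i}) (discrete_deriv i f) T"
proof -
  have A: "A = insert i (A - {i})" using assms by auto
  have "coef A (\<lambda>x. of_bool (f x)) (insert i T)
    = coef (insert i (A - {i})) (\<lambda>x. of_bool (f x)) (insert i T)" using A by simp
  also have "\<dots> = sqrt s2 * coef (A - {i}) (discrete_deriv i f) T"
    using assms by (subst coef_insert(2)) (auto simp: coef_def discrete_deriv_def left_diff_distrib E_diff)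
  finally show ?thesis .
qed

lemma discrete_deriv_01:
  assumes "monotone_bf A f" "i \<in> A" "x \<in> cube (A - {i})"
  shows "discrete_deriv i f x = of_bool (f (x(i := True)) \<noteq> f (x(i := False)))"
proof -
  have "x(i := False) \<in> cube A" "x(i := True) \<in> cube A"
    using assms(2,3) by (auto simp: cube_def PiE_dflt_def)
  then have "f (x(i := False)) \<le> f (x(i := True))"
    using assms(1) unfolding monotone_bf_def by (simp add: le_fun_def)
  then show ?thesis by (auto simp: discrete_deriv_def)
qed

lemma total_influence_eq:
  assumes "finite A" "monotone_bf A f"
  shows "total_influence p A f = (\<Sum>i\<in>A. E (A - {i}) (discrete_deriv i f))"
  unfolding total_influence_def
proof (intro sum.cong refl)
  fix i assume i: "i \<in> A"
  then have A: "A = insert i (A - {i})" by auto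
  have "measure_pmf.prob (biased p A) {x. f (flip i x) \<noteq> f x}
    = E A (\<lambda>x. of_bool (f (flip i x) \<noteq> f x))"
  proof -
    have "E A (\<lambda>x. of_bool (f (flip i x) \<noteq> f x)) = E A (indicator {x. f (flip i x) \<noteq> f x})"
      by (intro arg_cong[of _ _ "E A"]) (auto simp: fun_eq_iff)
    then show ?thesis by (simp add: E_def)
  qed
  \<comment> \<open>Whether \<open>i\<close> is pivotal does not depend on \<open>x i\<close>, so
    the two branches of \<open>E_insert\<close> agree and their masses add up to 1.\<close>
  also have "\<dots> = E (A - {i}) (\<lambda>x. of_bool (f (x(i := True)) \<noteq> f (x(i := False))))"
    using assms by (subst A, subst E_insert) (auto simp: flip_def eq_commute algebra_simps)
  also have "\<dots> = E (A - {i}) (discrete_deriv i f)"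
    using assms i by (intro E_cong) (auto simp: discrete_deriv_01)
  finally show "measure_pmf.prob (biased p A) {x. f (flip i x) \<noteq> f x} = E (A - {i}) (discrete_deriv i f)" .
qed

text \<open>Parseval for every derivative; by monotonicity each is an indicator and equals its
  square.\<close>

lemma influence_fourier:
  assumes "finite A" "monotone_bf A f"
  shows "(\<Sum>S\<in>Pow A. card S * (coef A (\<lambda>x. of_bool (f x)) S)\<^sup>2) = s2 * total_influence p A f"
proof -
  have "(\<Sum>S\<in>Pow A. card S * (coef A (\<lambda>x. of_bool (f x)) S)\<^sup>2)
    = (\<Sum>i\<in>A. \<Sum>T\<in>Pow (A - {i}). s2 * (coef (A - {i}) (discrete_deriv i f) T)\<^sup>2)"
    unfolding card_weighted_sum[OF assms(1)] using assms s2_pos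
    by (intro sum.cong refl) (auto simp: coef_discrete_deriv power_mult_distrib)
  also have "\<dots> = s2 * (\<Sum>i\<in>A. E (A - {i}) (\<lambda>x. (discrete_deriv i f x)\<^sup>2))"
    using assms by (simp add: sum_distrib_left[symmetric] parseval)
  also have "(\<Sum>i\<in>A. E (A - {i}) (\<lambda>x. (discrete_deriv i f x)\<^sup>2)) = total_influence p A f"
    unfolding total_influence_eq[OF assms] using assms
    by (intro sum.cong refl E_cong) (auto simp: discrete_deriv_01)
  finally show ?thesis .
qed

lemma coef_empty: "coef A (\<lambda>x. of_bool (f x)) {} = mu p A f"
  by (simp add: coef_def chi_def mu_eq)

lemma variance_fourier:
  assumes "finite A"
  shows "(\<Sum>S\<in>Pow A - {{}}. (coef A (\<lambda>x. of_bool (f x)) S)\<^sup>2) = mu p A f * (1 - mu p A f)"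
proof -
  have "(\<Sum>S\<in>Pow A. (coef A (\<lambda>x. of_bool (f x)) S)\<^sup>2) = mu p A f"
    unfolding parseval[OF assms] by (simp add: mu_eq power2_eq_square flip: of_bool_conj)
  then show ?thesis
    using assms by (simp add: sum_diff1 coef_empty power2_eq_square algebra_simps)
qed

section \<open>Low-degree weight and the final contradiction\<close>

text \<open>The left-hand side is the squared norm of the truncation \<open>h\<close> of
  \<open>sqrt s2\<close> times the derivative, hence also their correlation. The fourth moment of
  \<open>h\<close> is bounded by a small multiple of that same norm, so its contribution can be
  absorbed.\<close>

lemma low_degree_deriv_weight:
  assumes "finite A" "monotone_bf A f" "p \<le> 1 / 2" "i \<in> A" "0 \<le> \<delta>" "0 < \<tau>"
    and "256 ^ r * \<delta> \<le> \<tau> ^ 3 / 2"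
    and no_boost: "\<And>J. J \<subseteq> A \<Longrightarrow> card J \<le> r \<Longrightarrow>
      mu p (A - J) (restrict_one J f) \<le> mu p A f + \<delta>"
  shows "(\<Sum>T\<in>{T\<in>Pow (A - {i}). card T < r}. (coef A (\<lambda>x. of_bool (f x)) (insert i T))\<^sup>2)
    \<le> 2 * \<tau> * s2 * E (A - {i}) (discrete_deriv i f)"
proof -
  define B where "B = A - {i}"
  define F where "F = coef A (\<lambda>x. of_bool (f x))"
  define a where "a T = (if card T < r then F (insert i T) else 0)" for T
  define h where "h x = (\<Sum>T\<in>Pow B. a T * chi T x)" for x
  define N where "N = (\<Sum>T\<in>Pow B. (a T)\<^sup>2)"
  have fin: "finite B" using assms by (simp add: B_def)
  have N: "N = (\<Sum>T\<in>{T\<in>Pow B. card T < r}. (F (insert i T))\<^sup>2)"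
    unfolding N_def a_def using fin
    by (subst sum.inter_filter) (auto intro: sum.cong)
  \<comment> \<open>Weight of the derivative above \<open>U\<close> is weight of f above
    \<open>insert i U\<close>, a set of size at most \<open>r\<close>, to which the assumption on
    boosts applies. Here 8 is 4 from \<open>W_coef_le\<close> times 2 from
    \<open>mu_restrict_diff_le\<close>.\<close>
  have W_a: "W B a U \<le> (8 * s2) ^ Suc (card U) * \<delta>" if U: "U \<subseteq> B" "card U < r" for U
  proof -
    have U': "finite U" "i \<notin> U" "insert i U \<subseteq> A" "i \<notin> B" "A = insert i B"
      using U fin finite_subset assms(4) by (auto simp: B_def)
    have "W B a U \<le> W B (\<lambda>T. F (insert i T)) U"
      unfolding W_def a_def by (intro sum_mono) auto
    also have "\<dots> = W A F (insert i U)"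
      using W_insert(2)[OF fin U'(4) U(1)] U'(5) by simp
    also have "\<dots> \<le> (4 * s2) ^ card (insert i U)
        * (mu p (A - insert i U) (restrict_one (insert i U) f) - mu p (A - insert i U) f)"
      unfolding F_def using assms U' by (intro W_coef_le) auto
    also have "\<dots> \<le> (4 * s2) ^ card (insert i U) * (2 ^ card (insert i U) * \<delta>)"
      using assms U U' s2_pos
      by (intro mult_left_mono mu_restrict_diff_le no_boost) auto
    also have "\<dots> = (8 * s2) ^ Suc (card U) * \<delta>"
      using U' by (simp add: power_mult_distrib mult.assoc[symmetric])
        (simp add: power_mult_distrib[symmetric] mult_ac)
    finally show ?thesis .
  qed
  have fourth: "E B (\<lambda>x. h x ^ 4) \<le> s2 * 256 ^ r * \<delta> * N"
    unfolding h_def N_def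
    by (rule low_degree_fourth_moment[OF fin _ assms(5) W_a]) (auto simp: a_def)
  \<comment> \<open>The threshold scales with \<open>sqrt s2\<close>, so that
    \<open>sqrt s2 * t\<close> is \<open>s2 * \<tau>\<close> while all powers of \<open>s2\<close>
    cancel in the quartic term.\<close>
  define t where "t = sqrt s2 * \<tau>"
  have t: "0 < t" using s2_pos assms(6) by (simp add: t_def)
  \<comment> \<open>Where the discrete derivative is 1, either \<open>h \<le> t\<close> or \<open>h \<le> h^4 / t^3\<close>.\<close>
  have pt: "discrete_deriv i f x * h x \<le> t * discrete_deriv i f x + (1 / t ^ 3) * h x ^ 4"
    if x: "x \<in> cube B" for x
  proof -
    have "h x \<le> t + (1 / t ^ 3) * h x ^ 4"
    proof (cases "h x \<le> t")
      case True
      moreover have "0 \<le> (1 / t ^ 3) * h x ^ 4" using t by simp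
      ultimately show ?thesis by linarith
    next
      case False
      then have "t ^ 3 \<le> h x ^ 3" using t by (intro power_mono) auto
      then have "t ^ 3 * h x \<le> h x ^ 3 * h x" using t False by (intro mult_right_mono) auto
      also have "h x ^ 3 * h x = h x ^ 4" by (simp add: eval_nat_numeral)
      finally have "h x \<le> (1 / t ^ 3) * h x ^ 4" using t by (simp add: field_simps)
      then show ?thesis using t by linarith
    qed
    moreover have "0 \<le> (1 / t ^ 3) * h x ^ 4" using t by simp
    ultimately show ?thesis
      using discrete_deriv_01[OF assms(2,4)] x by (auto simp: B_def)
  qed
  have "N = (\<Sum>T\<in>Pow B. a T * (sqrt s2 * coef B (discrete_deriv i f) T))"
    unfolding N_def using assms(1,4)
    by (intro sum.cong refl) (auto simp: a_def F_def B_def coef_discrete_deriv power2_eq_square)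
  also have "\<dots> = sqrt s2 * E B (\<lambda>x. discrete_deriv i f x * h x)"
  proof -
    have "E B (\<lambda>x. discrete_deriv i f x * h x) = E B (\<lambda>x. \<Sum>T\<in>Pow B. a T * (discrete_deriv i f x * chi T x))"
      by (simp add: h_def sum_distrib_left mult_ac)
    also have "\<dots> = (\<Sum>T\<in>Pow B. a T * coef B (discrete_deriv i f) T)"
      using fin by (simp add: E_sum E_cmult coef_def)
    finally show ?thesis by (simp add: sum_distrib_left mult_ac)
  qed
  also have "\<dots> \<le> sqrt s2 * E B (\<lambda>x. t * discrete_deriv i f x + (1 / t ^ 3) * h x ^ 4)"
    using fin pt s2_pos by (intro mult_left_mono E_mono) auto
  also have "\<dots> = sqrt s2 * (t * E B (discrete_deriv i f) + (1 / t ^ 3) * E B (\<lambda>x. h x ^ 4))"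
    using fin by (simp only: E_add E_cmult)
  also have "\<dots> \<le> sqrt s2 * (t * E B (discrete_deriv i f) + (1 / t ^ 3) * (s2 * 256 ^ r * \<delta> * N))"
    using fourth t s2_pos by (intro mult_left_mono add_left_mono) auto
  also have "\<dots> = s2 * \<tau> * E B (discrete_deriv i f) + (256 ^ r * \<delta> / \<tau> ^ 3) * N"
  proof -
    have "t ^ 3 = s2 * sqrt s2 * \<tau> ^ 3"
      using s2_pos by (simp add: t_def power_mult_distrib power3_eq_cube)
    then have inv: "sqrt s2 * (1 / t ^ 3) * s2 = 1 / \<tau> ^ 3"
      using s2_pos by simp
    have st: "sqrt s2 * t = s2 * \<tau>" using s2_pos by (simp add: t_def)
    have "sqrt s2 * (t * X + (1 / t ^ 3) * (s2 * 256 ^ r * \<delta> * N))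
      = (sqrt s2 * t) * X + (sqrt s2 * (1 / t ^ 3) * s2) * (256 ^ r * \<delta> * N)" for X
      by (simp only: ring_distribs mult_ac)
    then show ?thesis unfolding st inv by simp
  qed
  \<comment> \<open>The smallness of \<delta> bounds the coefficient of \<open>N\<close> by 1/2;
    half of \<open>N\<close> then moves to the left.\<close>
  also have "\<dots> \<le> s2 * \<tau> * E B (discrete_deriv i f) + 1 / 2 * N"
  proof -
    have "256 ^ r * \<delta> / \<tau> ^ 3 \<le> 1 / 2" using assms(6,7) by (simp add: field_simps)
    moreover have "0 \<le> N" by (simp add: N_def sum_nonneg)
    ultimately show ?thesis by (intro add_left_mono mult_right_mono)
  qed
  finally have "N \<le> 2 * \<tau> * s2 * E B (discrete_deriv i f)" by (simp add: mult_ac)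
  then show ?thesis by (simp add: N B_def F_def)
qed

lemma variance_le_of_no_boost:
  assumes "finite A" "monotone_bf A f" "p \<le> 1 / 2" "0 \<le> \<delta>" "0 < \<tau>" "0 < r"
    and "256 ^ r * \<delta> \<le> \<tau> ^ 3 / 2"
    and no_boost: "\<And>J. J \<subseteq> A \<Longrightarrow> card J \<le> r \<Longrightarrow>
      mu p (A - J) (restrict_one J f) \<le> mu p A f + \<delta>"
  shows "mu p A f * (1 - mu p A f) \<le> (2 * \<tau> + 1 / r) * (s2 * total_influence p A f)"
proof -
  define F where "F = coef A (\<lambda>x. of_bool (f x))"
  define g where "g S = (if card S \<le> r then (F S)\<^sup>2 else 0)" for S
  \<comment> \<open>A nonempty set on a level up to \<open>r\<close> is paid for by the first term,
    one on a higher level by the second, where \<open>card S / r\<close> exceeds 1.\<close>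
  have pt: "(F S)\<^sup>2 \<le> real (card S) * g S + (1 / real r) * (real (card S) * (F S)\<^sup>2)" if S: "S \<in> Pow A - {{}}" for S
  proof -
    have "finite S" using S assms(1) finite_subset by auto
    then have "1 \<le> card S" using S by (simp add: Suc_le_eq card_gt_0_iff)
    then have 1: "1 * (F S)\<^sup>2 \<le> card S * (F S)\<^sup>2" by (intro mult_right_mono) auto
    have 2: "0 \<le> (1 / r) * (card S * (F S)\<^sup>2)" by simp
    show ?thesis
    proof (cases "card S \<le> r")
      case True
      with 1 have "(F S)\<^sup>2 \<le> card S * g S" by (simp add: g_def)
      with 2 show ?thesis by linarith
    next
      case False
      then have "1 * (F S)\<^sup>2 \<le> (card S / r) * (F S)\<^sup>2"
        using assms(6) by (intro mult_right_mono) auto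
      then show ?thesis using False by (simp add: g_def)
    qed
  qed
  have "mu p A f * (1 - mu p A f)
    \<le> (\<Sum>S\<in>Pow A - {{}}. card S * g S + (1 / r) * (card S * (F S)\<^sup>2))"
    unfolding variance_fourier[OF assms(1), symmetric] F_def[symmetric] by (intro sum_mono pt)
  also have "\<dots> = (\<Sum>S\<in>Pow A. card S * g S + (1 / r) * (card S * (F S)\<^sup>2))"
    using assms(1) by (intro sum.mono_neutral_left) auto
  also have "\<dots> = (\<Sum>S\<in>Pow A. card S * g S) + (1 / r) * (\<Sum>S\<in>Pow A. card S * (F S)\<^sup>2)"
    by (simp only: sum.distrib sum_distrib_left)
  also have "(\<Sum>S\<in>Pow A. card S * (F S)\<^sup>2) = s2 * total_influence p A f"
    unfolding F_def by (rule influence_fourier[OF assms(1,2)])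
  also have "(\<Sum>S\<in>Pow A. card S * g S) \<le> (\<Sum>i\<in>A. 2 * \<tau> * s2 * E (A - {i}) (discrete_deriv i f))"
    unfolding card_weighted_sum[OF assms(1)]
  proof (intro sum_mono)
    fix i assume i: "i \<in> A"
    \<comment> \<open>Removing \<open>i\<close> lowers the level by one: levels up to
      \<open>r\<close> of f become levels strictly below \<open>r\<close> of the derivative.\<close>
    have "(\<Sum>T\<in>Pow (A - {i}). g (insert i T))
      = (\<Sum>T\<in>Pow (A - {i}). if card T < r then (F (insert i T))\<^sup>2 else 0)"
    proof (intro sum.cong refl)
      fix T assume "T \<in> Pow (A - {i})"
      then have "finite T" "i \<notin> T" using assms(1) finite_subset by auto
      then show "g (insert i T) = (if card T < r then (F (insert i T))\<^sup>2 else 0)"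
        by (simp add: g_def Suc_le_eq)
    qed
    also have "\<dots> = (\<Sum>T\<in>{T\<in>Pow (A - {i}). card T < r}. (F (insert i T))\<^sup>2)"
      using assms(1) by (intro sum.inter_filter[symmetric]) auto
    also have "\<dots> \<le> 2 * \<tau> * s2 * E (A - {i}) (discrete_deriv i f)"
      unfolding F_def using assms i by (intro low_degree_deriv_weight) auto
    finally show "(\<Sum>T\<in>Pow (A - {i}). g (insert i T)) \<le> 2 * \<tau> * s2 * E (A - {i}) (discrete_deriv i f)" .
  qed
  also have "\<dots> = 2 * \<tau> * (s2 * total_influence p A f)"
    unfolding total_influence_eq[OF assms(1,2)] by (simp add: sum_distrib_left mult_ac)
  finally show ?thesis by (simp add: algebra_simps)
qed

text \<open>Nonempty sets have level at least 1. Used to bound \<open>K\<close> below by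
  \<open>c / 2\<close>.\<close>

lemma poincare:
  assumes "finite A" "monotone_bf A f"
  shows "mu p A f * (1 - mu p A f) \<le> s2 * total_influence p A f"
proof -
  have "(\<Sum>S\<in>Pow A - {{}}. 1 * (coef A (\<lambda>x. of_bool (f x)) S)\<^sup>2)
    \<le> (\<Sum>S\<in>Pow A - {{}}. card S * (coef A (\<lambda>x. of_bool (f x)) S)\<^sup>2)"
  proof (intro sum_mono mult_right_mono)
    fix S assume S: "S \<in> Pow A - {{}}"
    then have "finite S" using assms(1) finite_subset by auto
    then show "1 \<le> real (card S)" using S by (simp add: Suc_le_eq card_gt_0_iff)
  qed auto
  also have "\<dots> \<le> (\<Sum>S\<in>Pow A. card S * (coef A (\<lambda>x. of_bool (f x)) S)\<^sup>2)"
    using assms(1) by (intro sum_mono2) auto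
  finally show ?thesis
    by (simp add: variance_fourier[OF assms(1)] influence_fourier[OF assms])
qed

lemma boost_exists:
  assumes "finite A" "monotone_bf A f" "p \<le> 1 / 2" "0 < c" "c < 1 / 2"
    and mu: "c \<le> mu p A f" "mu p A f \<le> 1 - c"
    and infl: "total_influence p A f \<le> K / p"
  shows "\<exists>J. J \<subseteq> A \<and> real (card J) \<le> 120 / c * K \<and>
    mu p (A - J) (restrict_one J f) \<ge> mu p A f + exp (- (120 / c * K))"
proof -
  \<comment> \<open>The degree \<open>r\<close> makes \<open>3 * K / r\<close> at most
    \<open>3 * c / 8\<close>, below the variance bound \<open>c / 2\<close>. The exponent 12 in
    \<delta> is 8 from \<open>256 ^ r\<close>, 3 from \<open>\<tau> ^ 3\<close>, and one more factor
    \<open>(1 / 2) ^ r\<close> to supply the required 1/2.\<close>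
  define r where "r = nat \<lceil>8 * K / c\<rceil>"
  define \<delta> :: real where "\<delta> = (1 / 2) ^ (12 * r)"
  define \<tau> :: real where "\<tau> = (1 / 2) ^ r"
  have sI: "s2 * total_influence p A f \<le> K"
  proof -
    have "s2 * total_influence p A f \<le> s2 * (K / p)"
      using infl s2_pos by (intro mult_left_mono) auto
    also have "\<dots> = (1 - p) * K" using p_pos by (simp add: s2_def)
    finally have *: "s2 * total_influence p A f \<le> (1 - p) * K" .
    have "0 \<le> total_influence p A f" unfolding total_influence_def by (intro sum_nonneg) auto
    then have "0 \<le> K / p" using infl by linarith
    then have "0 \<le> K" using p_pos by (simp add: zero_le_divide_iff)
    then have "(1 - p) * K \<le> 1 * K" using p_pos by (intro mult_right_mono) auto
    with * show ?thesis by simp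
  qed
  have var: "c / 2 \<le> mu p A f * (1 - mu p A f)"
  proof -
    \<comment> \<open>This product is the variance minus \<open>c * (1 - c)\<close>, so the variance
      is smallest at the ends of the allowed range.\<close>
    have "0 \<le> (mu p A f - c) * (1 - c - mu p A f)" using mu by (intro mult_nonneg_nonneg) auto
    also have "\<dots> = mu p A f * (1 - mu p A f) - c * (1 - c)" by (simp add: algebra_simps)
    finally have "c * (1 - c) \<le> mu p A f * (1 - mu p A f)" by simp
    moreover have "c * (1 / 2) \<le> c * (1 - c)" using assms by (intro mult_left_mono) auto
    ultimately show ?thesis by simp
  qed
  have K: "c / 2 \<le> K" using var poincare[OF assms(1,2)] sI by linarith
  have r_lower: "8 * K / c \<le> r" unfolding r_def by (simp add: real_nat_ceiling_ge)
  have r_upper: "real r \<le> 10 * K / c"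
  proof -
    have "0 \<le> 8 * K / c" using K assms(4) by simp
    then have "real r \<le> 8 * K / c + 1" unfolding r_def by linarith
    \<comment> \<open>The rounding error is absorbed by \<open>c / 2 \<le> K\<close>, which raises 8
      to 10.\<close>
    also have "1 \<le> 2 * K / c" using K assms(4) by (simp add: field_simps)
    finally show ?thesis by (simp add: add_divide_distrib[symmetric])
  qed
  have r_pos: "0 < r"
    using r_lower K assms(4) by (intro Nat.gr0I) (auto simp: divide_le_0_iff)
  have "\<exists>J. J \<subseteq> A \<and> card J \<le> r \<and> mu p A f + \<delta> < mu p (A - J) (restrict_one J f)"
  proof (rule ccontr)
    assume "\<not> ?thesis"
    then have nb: "\<And>J. J \<subseteq> A \<Longrightarrow> card J \<le> r \<Longrightarrow>
      mu p (A - J) (restrict_one J f) \<le> mu p A f + \<delta>" by (meson not_le)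
    have "256 ^ r * \<delta> = \<tau> ^ 3 * (1 / 2) ^ r"
    proof -
      have "(256::real) ^ r = 2 ^ (8 * r)" by (simp add: power_mult)
      then show ?thesis unfolding \<delta>_def \<tau>_def
        by (simp add: power_one_over power_mult[symmetric] power_add[symmetric] field_simps)
    qed
    also have "\<dots> \<le> \<tau> ^ 3 * (1 / 2) ^ 1"
      using r_pos by (intro mult_left_mono power_decreasing) (auto simp: \<tau>_def)
    finally have "256 ^ r * \<delta> \<le> \<tau> ^ 3 / 2" by simp
    then have "mu p A f * (1 - mu p A f) \<le> (2 * \<tau> + 1 / r) * (s2 * total_influence p A f)"
      using assms nb r_pos
      by (intro variance_le_of_no_boost[where \<delta> = \<delta>]) (auto simp: \<delta>_def \<tau>_def)
    also have "\<dots> \<le> (2 * (1 / real r) + 1 / real r) * K"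
    proof (rule mult_mono[OF add_right_mono sI])
      have "real r \<le> 2 ^ r" by (rule of_nat_less_two_power[THEN less_imp_le])
      then show "2 * \<tau> \<le> 2 * (1 / r)"
        using r_pos by (simp add: \<tau>_def power_one_over field_simps)
      show "0 \<le> s2 * total_influence p A f" using s2_pos
        unfolding total_influence_def by (intro mult_nonneg_nonneg sum_nonneg) auto
    qed simp
    also have "\<dots> = 3 * K / r" by (simp add: field_simps)
    also have "\<dots> \<le> 3 * c / 8"
      using r_lower r_pos assms(4) by (simp add: field_simps)
    finally show False using var assms(4) by simp
  qed
  then obtain J where J: "J \<subseteq> A" "card J \<le> r"
    "mu p A f + \<delta> < mu p (A - J) (restrict_one J f)" by blast
  \<comment> \<open>The constant 120 is 12, the exponent in \<delta>, times 10, from the bound on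
    \<open>r\<close>; base 2 is exchanged for e.\<close>
  have "exp (- (120 / c * K)) \<le> exp (- (12 * real r))" using r_upper by simp
  also have "\<dots> = exp (- 1) ^ (12 * r)" by (simp add: exp_of_nat_mult[symmetric])
  also have "\<dots> \<le> \<delta>"
  proof -
    have "(2::real) \<le> exp 1" using exp_ge_add_one_self[of 1] by simp
    then have "exp (- 1) \<le> (1 / 2 :: real)" by (simp add: exp_minus field_simps)
    then show ?thesis unfolding \<delta>_def by (intro power_mono) auto
  qed
  finally have "mu p A f + exp (- (120 / c * K)) \<le> mu p (A - J) (restrict_one J f)"
    using J(3) by linarith
  moreover have "real (card J) \<le> 120 / c * K"
  proof -
    have "real (card J) \<le> 10 * K / c" using J(2) r_upper by linarith
    also have "\<dots> \<le> 120 / c * K" using K assms(4) by (simp add: field_simps)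
    finally show ?thesis .
  qed
  ultimately show ?thesis using J(1) by blast
qed

end

theorem theorem1p4:
  fixes c :: real
  assumes "0 < c" and "c < 1 / 2"
  shows "\<exists>C::real. C > 0 \<and>
    (\<forall>(p::real) (K::real) (n::nat) (f :: (nat \<Rightarrow> bool) \<Rightarrow> bool).
       0 < p \<and> p \<le> 1 / 2 \<and> K > 0 \<and>
       monotone_bf {1..n} f \<and>
       c \<le> mu p {1..n} f \<and> mu p {1..n} f \<le> 1 - c \<and>
       total_influence p {1..n} f \<le> K / p \<longrightarrow>
       (\<exists>J. J \<subseteq> {1..n} \<and> real (card J) \<le> C * K \<and>
          mu p ({1..n} - J) (restrict_one J f) \<ge> mu p {1..n} f + exp (- (C * K))))"
proof (intro exI[of _ "120 / c"] conjI allI impI)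
  show "0 < 120 / c" using assms by simp
next
  fix p K :: real and n :: nat and f :: "(nat \<Rightarrow> bool) \<Rightarrow> bool"
  assume *: "0 < p \<and> p \<le> 1 / 2 \<and> K > 0 \<and> monotone_bf {1..n} f \<and>
    c \<le> mu p {1..n} f \<and> mu p {1..n} f \<le> 1 - c \<and> total_influence p {1..n} f \<le> K / p"
  then interpret biased_cube p by unfold_locales auto
  show "\<exists>J. J \<subseteq> {1..n} \<and> real (card J) \<le> 120 / c * K \<and>
    mu p ({1..n} - J) (restrict_one J f) \<ge> mu p {1..n} f + exp (- (120 / c * K))"
    using * assms by (intro boost_exists) auto
qed

end
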